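(* There exists a total recursive quasi-block function $f\colon\omega\to\omega$ such that $f$ has a non-decreasing lower bound diverging to $+\infty$ (a non-decreasing $h$ with $h(n)\le f(n)$ for all $n$ and $\lim_n h(n)=+\infty$), but has no computable such lower bound, and whose degree spectrum on $(\omega,<)$ is exactly the set of all c.e. Turing degrees.
   Context: $f$ is a quasi-block function if there are arbitrarily long finite initial segments of $(\omega,<)$ closed under $f$. A computable copy of $(\omega,<)$ is $(\omega,\prec)$ with $\prec$ computable and isomorphic to $(\omega,<)$; $f_{\mathcal A}$ is the image of the graph of $f$ in $\mathcal A$ under the isomorphism; the degree spectrum of $f$ is the set of Turing degrees of $f_{\mathcal A}$ over all computable copies $\mathcal A$. *)

theory Defs
  imports Complex_Main "HOL-Library.Nat_Bijection"
begin

section \<open>Oracle computability\<close>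

text \<open>
  Kleene's schemes for the partial recursive functions, extended by the characteristic function
  of an oracle set.  Codes carry no arity: \<^term>\<open>eval A e xs y\<close> says that the
  partial function of arity \<^term>\<open>length xs\<close> denoted by the code \<open>e\<close>
  converges on \<open>xs\<close> with value \<open>y\<close>.  A code that does not fit the arity simply diverges.
  In \<open>PrimRec\<close> and \<open>Mu\<close> the recursion variable, resp. the searched variable,
  is the first argument.
\<close>

datatype code =
    Zero
  | Succ
  | Proj nat
  | Oracle
  | Comp code "code list"
  | PrimRec code code
  | Mu code

inductive eval :: "nat set \<Rightarrow> code \<Rightarrow> nat list \<Rightarrow> nat \<Rightarrow> bool" for A :: "nat set" where
  eval_Zero: "eval A Zero xs 0"
| eval_Succ: "eval A Succ [x] (Suc x)"
| eval_Proj: "i < length xs \<Longrightarrow> eval A (Proj i) xs (xs ! i)"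
| eval_Oracle: "eval A Oracle [x] (of_bool (x \<in> A))"
| eval_Comp: "list_all2 (\<lambda>g y. eval A g xs y) gs ys \<Longrightarrow> eval A f ys z \<Longrightarrow> eval A (Comp f gs) xs z"
| eval_PrimRec_0: "eval A f xs y \<Longrightarrow> eval A (PrimRec f g) (0 # xs) y"
| eval_PrimRec_Suc: "eval A (PrimRec f g) (n # xs) r \<Longrightarrow> eval A g (n # r # xs) y \<Longrightarrow>
    eval A (PrimRec f g) (Suc n # xs) y"
| eval_Mu: "eval A f (n # xs) 0 \<Longrightarrow> (\<forall>m<n. \<exists>k. eval A f (m # xs) (Suc k)) \<Longrightarrow>
    eval A (Mu f) xs n"

inductive_cases eval_ZeroE: "eval A Zero xs z"
inductive_cases eval_SuccE: "eval A Succ xs z"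
inductive_cases eval_ProjE: "eval A (Proj i) xs z"
inductive_cases eval_OracleE: "eval A Oracle xs z"
inductive_cases eval_CompE: "eval A (Comp f gs) xs z"
inductive_cases eval_PrimRec_0E: "eval A (PrimRec f g) (0 # xs) z"
inductive_cases eval_PrimRec_SucE: "eval A (PrimRec f g) (Suc n # xs) z"
inductive_cases eval_MuE: "eval A (Mu f) xs z"

lemma eval_deterministic: "eval A e xs y \<Longrightarrow> eval A e xs z \<Longrightarrow> y = z"
proof (induction arbitrary: z rule: eval.induct)
  case (eval_Comp xs gs ys f z z')
  from eval_Comp.prems obtain ys'
    where ys': "list_all2 (\<lambda>g y. eval A g xs y) gs ys'" "eval A f ys' z'"
    by (rule eval_CompE)
  have "ys = ys'"
    using eval_Comp.IH(1) ys'(1) by (auto simp: list_all2_conv_all_nth intro: nth_equalityI)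
  then show ?case using eval_Comp.IH(2) ys'(2) by blast
next
  case (eval_PrimRec_Suc f g n xs r y)
  from eval_PrimRec_Suc.prems obtain r'
    where "eval A (PrimRec f g) (n # xs) r'" "eval A g (n # r' # xs) z"
    by (rule eval_PrimRec_SucE)
  then show ?case using eval_PrimRec_Suc.IH by blast
next
  case (eval_Mu f n xs z)
  from eval_Mu.prems have z: "eval A f (z # xs) 0" "\<forall>m<z. \<exists>k. eval A f (m # xs) (Suc k)"
    by (blast elim: eval_MuE)+
  have "\<not> z < n" using eval_Mu.IH(2) z(1) by (metis nat.distinct(1))
  moreover have "\<not> n < z" using eval_Mu.IH(1) z(2) by (metis nat.distinct(1))
  ultimately show ?case by simp
qed (blast elim: eval_ZeroE eval_SuccE eval_ProjE eval_OracleE eval_PrimRec_0E)+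

definition recursive_in :: "nat set \<Rightarrow> (nat \<Rightarrow> nat) \<Rightarrow> bool" where
  "recursive_in A f \<longleftrightarrow> (\<exists>e. \<forall>n. eval A e [n] (f n))"

definition computable :: "(nat \<Rightarrow> nat) \<Rightarrow> bool" where
  "computable f \<longleftrightarrow> recursive_in {} f"

definition turing_reducible :: "nat set \<Rightarrow> nat set \<Rightarrow> bool" (infix \<open>\<le>\<^sub>T\<close> 50) where
  "B \<le>\<^sub>T A \<longleftrightarrow> recursive_in A (\<lambda>n. of_bool (n \<in> B))"

definition computable_set :: "nat set \<Rightarrow> bool" where
  "computable_set B \<longleftrightarrow> computable (\<lambda>n. of_bool (n \<in> B))"

definition ce_set :: "nat set \<Rightarrow> bool" where
  "ce_set B \<longleftrightarrow> (\<exists>e. B = {n. \<exists>y. eval {} e [n] y})"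

definition turing_degree :: "nat set \<Rightarrow> nat set set" where
  "turing_degree A = {B. A \<le>\<^sub>T B \<and> B \<le>\<^sub>T A}"

definition ce_degrees :: "nat set set set" where
  "ce_degrees = {turing_degree B | B. ce_set B}"

section \<open>Computable copies and degree spectra\<close>

definition iso_from_omega :: "(nat \<times> nat) set \<Rightarrow> (nat \<Rightarrow> nat) \<Rightarrow> bool" where
  "iso_from_omega R \<phi> \<longleftrightarrow> bij \<phi> \<and> (\<forall>x y. x < y \<longleftrightarrow> (\<phi> x, \<phi> y) \<in> R)"

definition computable_copy :: "(nat \<times> nat) set \<Rightarrow> bool" where
  "computable_copy R \<longleftrightarrow> computable_set (prod_encode ` R) \<and> (\<exists>\<phi>. iso_from_omega R \<phi>)"

definition image_of_graph :: "(nat \<Rightarrow> nat) \<Rightarrow> (nat \<Rightarrow> nat) \<Rightarrow> (nat \<times> nat) set" where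
  "image_of_graph \<phi> f = {(\<phi> x, \<phi> (f x)) | x. True}"

text \<open>The isomorphism from \<open>\<omega>\<close> onto a copy is unique, so every copy contributes one degree.\<close>

definition degree_spectrum :: "(nat \<Rightarrow> nat) \<Rightarrow> nat set set set" where
  "degree_spectrum f =
    {turing_degree (prod_encode ` image_of_graph \<phi> f) | R \<phi>.
      computable_copy R \<and> iso_from_omega R \<phi>}"

section \<open>Quasi-block functions and lower bounds\<close>

definition quasi_block :: "(nat \<Rightarrow> nat) \<Rightarrow> bool" where
  "quasi_block f \<longleftrightarrow> (\<forall>n. \<exists>m\<ge>n. f ` {..<m} \<subseteq> {..<m})"

definition diverging_lower_bound :: "(nat \<Rightarrow> nat) \<Rightarrow> (nat \<Rightarrow> nat) \<Rightarrow> bool" where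
  "diverging_lower_bound h f \<longleftrightarrow>
    mono h \<and> (\<forall>n. h n \<le> f n) \<and> filterlim h at_top sequentially"

end

theory Submission
  imports Defs
begin

text \<open>
  Fix a c.e. set \<open>K\<close> that is not computable and let \<open>key \<langle>n, s\<rangle>\<close> be \<open>n\<close> if \<open>n\<close> enters \<open>K\<close> at
  stage \<open>s\<close> and \<open>\<langle>n, s\<rangle>\<close> otherwise.  Take \<open>f 0 = 0\<close>, \<open>f (2 n + 2) = 2 n\<close> and \<open>f (2 n + 1) = 2 key n\<close>.
  Since \<open>f n \<le> n\<close>, every initial segment is closed, and since \<open>key\<close> is finite-to-one, \<open>f\<close>
  diverges; but a computable diverging lower bound of \<open>f\<close> would bound the stages at which
  numbers enter \<open>K\<close>.

  The range of \<open>f\<close> consists of the even numbers and \<open>f\<close> counts them down to \<open>0\<close>.  Hence in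
  every computable copy the image of \<open>f\<close> computes the position of each of its values, and so
  all positions.  It is therefore Turing equivalent to the position function, which is
  approximable from below and thus of c.e. degree.  Conversely, for a c.e. set \<open>B\<close> with its own
  function \<open>key\<close>, ordering the numbers lexicographically by \<open>(key x, x)\<close> gives a copy whose
  position function is Turing equivalent to \<open>B\<close>.
\<close>

section \<open>A calculus of recursive functions\<close>

lemma eval_Comp1: "eval A g xs y \<Longrightarrow> eval A f [y] z \<Longrightarrow> eval A (Comp f [g]) xs z"
  by (rule eval_Comp[of _ _ _ "[y]"]) auto

lemma eval_Comp2:
  "eval A g xs y \<Longrightarrow> eval A g' xs y' \<Longrightarrow> eval A f [y, y'] z \<Longrightarrow> eval A (Comp f [g, g']) xs z"
  by (rule eval_Comp[of _ _ _ "[y, y']"]) auto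

lemma eval_Proj_0: "eval A (Proj 0) (x # xs) x"
  using eval_Proj[of 0 "x # xs"] by simp

lemma eval_Proj_1: "eval A (Proj 1) (x # y # xs) y"
  using eval_Proj[of 1 "x # y # xs"] by simp

lemma eval_Proj_2: "eval A (Proj 2) (x # y # z # xs) z"
  using eval_Proj[of 2 "x # y # z # xs"] by simp

definition add_code :: code where
  "add_code = PrimRec (Proj 0) (Comp Succ [Proj 1])"

lemma eval_add_code: "eval A add_code [n, x] (n + x)"
proof (induction n)
  case 0
  show ?case unfolding add_code_def by (simp add: eval_PrimRec_0 eval_Proj_0)
next
  case (Suc n)
  show ?case unfolding add_code_def add_Suc
    by (rule eval_PrimRec_Suc Suc[unfolded add_code_def] eval_Comp1 eval_Proj_1 eval_Succ)+
qed

definition pred_code :: code where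
  "pred_code = PrimRec Zero (Proj 0)"

lemma eval_pred_code: "eval A pred_code [n] (n - 1)"
proof (induction n)
  case 0
  show ?case unfolding pred_code_def by (simp add: eval_PrimRec_0 eval_Zero)
next
  case (Suc n)
  show ?case unfolding pred_code_def diff_Suc_1
    by (rule eval_PrimRec_Suc Suc[unfolded pred_code_def] eval_Proj_0)+
qed

text \<open>Recursion runs on the first argument, so the subtrahend comes first.\<close>

definition sub_code :: code where
  "sub_code = PrimRec (Proj 0) (Comp pred_code [Proj 1])"

lemma eval_sub_code: "eval A sub_code [n, x] (x - n)"
proof (induction n)
  case 0
  show ?case unfolding sub_code_def by (simp add: eval_PrimRec_0 eval_Proj_0)
next
  case (Suc n)
  have "x - Suc n = x - n - 1" by simp
  then show ?case unfolding sub_code_def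
    by (simp only:)
      (rule eval_PrimRec_Suc Suc[unfolded sub_code_def] eval_Comp1 eval_Proj_1 eval_pred_code)+
qed

definition triangle_code :: code where
  "triangle_code = PrimRec Zero (Comp Succ [Comp add_code [Proj 0, Proj 1]])"

lemma eval_triangle_code: "eval A triangle_code [n] (triangle n)"
proof (induction n)
  case 0
  show ?case unfolding triangle_code_def by (simp add: eval_PrimRec_0 eval_Zero)
next
  case (Suc n)
  have "triangle (Suc n) = Suc (n + triangle n)" by simp
  then show ?case unfolding triangle_code_def
    by (simp only:) (rule eval_PrimRec_Suc Suc[unfolded triangle_code_def] eval_Comp1 eval_Comp2
        eval_Proj_0 eval_Proj_1 eval_Succ eval_add_code)+
qed

definition pair_code :: code where
  "pair_code = Comp add_code [Comp triangle_code [add_code], Proj 0]"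

lemma eval_pair_code: "eval A pair_code [m, n] (prod_encode (m, n))"
  unfolding pair_code_def prod_encode_def split
  by (rule eval_Comp2 eval_Comp1 eval_add_code eval_triangle_code eval_Proj_0)+

definition pfst :: "nat \<Rightarrow> nat" where "pfst z = fst (prod_decode z)"
definition psnd :: "nat \<Rightarrow> nat" where "psnd z = snd (prod_decode z)"

lemma pfst_prod_encode [simp]: "pfst (prod_encode (m, n)) = m"
  by (simp add: pfst_def)

lemma psnd_prod_encode [simp]: "psnd (prod_encode (m, n)) = n"
  by (simp add: psnd_def)

lemma prod_encode_pfst_psnd [simp]: "prod_encode (pfst z, psnd z) = z"
  by (simp add: pfst_def psnd_def)

lemma pfst_le: "pfst z \<le> z"
  by (metis le_prod_encode_1 prod_encode_pfst_psnd)

lemma triangle_mono: "m \<le> n \<Longrightarrow> triangle m \<le> triangle n"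
  by (induction n) (auto simp: le_Suc_eq)

text \<open>The Cantor code of \<open>(m, n)\<close> is \<open>triangle (m + n) + m\<close>, so the
  diagonal \<open>m + n\<close> of \<open>z\<close> is the least \<open>k\<close> with
  \<open>z < triangle (Suc k)\<close>. The search tests this as
  \<open>Suc z - triangle (Suc k) = 0\<close>.\<close>

definition diag_code :: code where
  "diag_code = Mu (Comp sub_code [Comp triangle_code [Comp Succ [Proj 0]], Comp Succ [Proj 1]])"

lemma eval_diag_code: "eval A diag_code [z] (pfst z + psnd z)"
proof -
  have z: "z = triangle (pfst z + psnd z) + pfst z"
    using prod_encode_pfst_psnd[of z] by (simp add: prod_encode_def)
  let ?c = "Comp sub_code [Comp triangle_code [Comp Succ [Proj 0]], Comp Succ [Proj 1]]"
  have ev: "eval A ?c [k, z] (Suc z - triangle (Suc k))" for k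
    by (rule eval_Comp2 eval_Comp1 eval_triangle_code eval_Proj_0 eval_Proj_1 eval_sub_code
        eval_Succ)+
  show ?thesis unfolding diag_code_def
  proof (rule eval_Mu)
    have "Suc z - triangle (Suc (pfst z + psnd z)) = 0" using z by simp
    then show "eval A ?c [pfst z + psnd z, z] 0" using ev by metis
    show "\<forall>m<pfst z + psnd z. \<exists>k. eval A ?c [m, z] (Suc k)"
    proof (intro allI impI)
      fix m assume "m < pfst z + psnd z"
      then have "triangle (Suc m) \<le> triangle (pfst z + psnd z)" by (intro triangle_mono) simp
      then have "Suc z - triangle (Suc m) = Suc (z - triangle (Suc m))" using z by linarith
      then show "\<exists>k. eval A ?c [m, z] (Suc k)" using ev by metis
    qed
  qed
qed

definition pfst_code :: code where
  "pfst_code = Comp sub_code [Comp triangle_code [diag_code], Proj 0]"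

lemma eval_pfst_code: "eval A pfst_code [z] (pfst z)"
proof -
  have z: "z = triangle (pfst z + psnd z) + pfst z"
    using prod_encode_pfst_psnd[of z] by (simp add: prod_encode_def)
  have "eval A pfst_code [z] (z - triangle (pfst z + psnd z))" unfolding pfst_code_def
    by (rule eval_Comp2 eval_Comp1 eval_triangle_code eval_diag_code eval_Proj_0 eval_sub_code)+
  moreover have "z - triangle (pfst z + psnd z) = pfst z" using z by linarith
  ultimately show ?thesis by simp
qed

definition psnd_code :: code where
  "psnd_code = Comp sub_code [pfst_code, diag_code]"

lemma eval_psnd_code: "eval A psnd_code [z] (psnd z)"
proof -
  have "eval A psnd_code [z] (pfst z + psnd z - pfst z)" unfolding psnd_code_def
    by (rule eval_Comp2 eval_pfst_code eval_diag_code eval_sub_code)+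
  then show ?thesis by simp
qed

section \<open>Closure of the recursive functions under composition, recursion and iteration\<close>

named_theorems recursive_intros

lemma recursive_comp: "recursive_in A f \<Longrightarrow> recursive_in A g \<Longrightarrow> recursive_in A (\<lambda>x. f (g x))"
  unfolding recursive_in_def by (blast intro: eval_Comp1)

lemma recursive_comp2:
  assumes "\<And>m n. eval A e [m, n] (f m n)" "recursive_in A g" "recursive_in A h"
  shows "recursive_in A (\<lambda>x. f (g x) (h x))"
  using assms unfolding recursive_in_def by (blast intro: eval_Comp2)

lemma recursive_id [recursive_intros]: "recursive_in A (\<lambda>x. x)"
  unfolding recursive_in_def by (blast intro: eval_Proj_0)

lemma recursive_Suc [recursive_intros]:
  "recursive_in A f \<Longrightarrow> recursive_in A (\<lambda>x. Suc (f x))"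
  by (rule recursive_comp[of _ Suc]) (auto simp: recursive_in_def intro: eval_Succ)

lemma recursive_const [recursive_intros]: "recursive_in A (\<lambda>x. c)"
proof (induction c)
  case 0
  show ?case unfolding recursive_in_def by (blast intro: eval_Zero)
qed (rule recursive_Suc)

lemma recursive_pfst [recursive_intros]:
  "recursive_in A f \<Longrightarrow> recursive_in A (\<lambda>x. pfst (f x))"
  by (rule recursive_comp[of _ pfst]) (auto simp: recursive_in_def intro: eval_pfst_code)

lemma recursive_psnd [recursive_intros]:
  "recursive_in A f \<Longrightarrow> recursive_in A (\<lambda>x. psnd (f x))"
  by (rule recursive_comp[of _ psnd]) (auto simp: recursive_in_def intro: eval_psnd_code)

lemma recursive_pair [recursive_intros]:
  "recursive_in A f \<Longrightarrow> recursive_in A g \<Longrightarrow> recursive_in A (\<lambda>x. prod_encode (f x, g x))"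
  by (rule recursive_comp2[OF eval_pair_code])

lemma recursive_add [recursive_intros]:
  "recursive_in A f \<Longrightarrow> recursive_in A g \<Longrightarrow> recursive_in A (\<lambda>x. f x + g x)"
  by (rule recursive_comp2[OF eval_add_code])

lemma recursive_diff [recursive_intros]:
  "recursive_in A f \<Longrightarrow> recursive_in A g \<Longrightarrow> recursive_in A (\<lambda>x. f x - g x)"
  by (rule recursive_comp2[OF eval_sub_code])

text \<open>Bound variables become projections of the argument, so that closure under the binders
  below can be checked by resolution with \<open>recursive_intros\<close> alone.\<close>

lemma recursive_rec_nat [recursive_intros]:
  assumes "recursive_in A f" "recursive_in A (\<lambda>z. g (pfst z) (pfst (psnd z)) (psnd (psnd z)))"
    and "recursive_in A t"
  shows "recursive_in A (\<lambda>x. rec_nat (f x) (\<lambda>k r. g k r x) (t x))"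
proof -
  obtain cf cg where cf: "\<And>n. eval A cf [n] (f n)"
    and cg: "\<And>z. eval A cg [z] (g (pfst z) (pfst (psnd z)) (psnd (psnd z)))"
    using assms unfolding recursive_in_def by blast
  \<comment> \<open>The code \<open>cg\<close> is unary, so the three arguments of the recursion
    step are packed into one number first.\<close>
  let ?G = "Comp cg [Comp pair_code [Proj 0, Comp pair_code [Proj 1, Proj 2]]]"
  have G: "eval A ?G [k, r, x] (g k r x)" for k r x
  proof (rule eval_Comp1)
    show "eval A (Comp pair_code [Proj 0, Comp pair_code [Proj 1, Proj 2]]) [k, r, x]
        (prod_encode (k, prod_encode (r, x)))"
      by (rule eval_Comp2 eval_pair_code eval_Proj_0 eval_Proj_1 eval_Proj_2)+
    show "eval A cg [prod_encode (k, prod_encode (r, x))] (g k r x)"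
      using cg[of "prod_encode (k, prod_encode (r, x))"] by simp
  qed
  have "eval A (PrimRec cf ?G) [n, x] (rec_nat (f x) (\<lambda>k r. g k r x) n)" for n x
  proof (induction n)
    case 0
    show ?case by (simp add: eval_PrimRec_0 cf)
  next
    case (Suc n)
    from eval_PrimRec_Suc[OF this G] show ?case by simp
  qed
  from recursive_comp2[OF this assms(3) recursive_id] show ?thesis .
qed

lemma recursive_funpow [recursive_intros]:
  assumes "recursive_in A f" "recursive_in A (\<lambda>z. g (psnd z) (pfst z))" "recursive_in A t"
  shows "recursive_in A (\<lambda>x. (g x ^^ t x) (f x))"
proof -
  \<comment> \<open>An iteration ignores the recursion counter, so the hypothesis on
    \<open>g\<close> is pulled back along the map that forgets it.\<close>
  have "recursive_in A (\<lambda>z. prod_encode (pfst (psnd z), psnd (psnd z)))"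
    by (intro recursive_intros)
  from recursive_comp[OF assms(2) this]
  have "recursive_in A (\<lambda>z. g (psnd (psnd z)) (pfst (psnd z)))"
    by (simp only: pfst_prod_encode psnd_prod_encode)
  then have "recursive_in A (\<lambda>x. rec_nat (f x) (\<lambda>k r. g x r) (t x))"
    by (intro recursive_rec_nat assms)
  moreover have "rec_nat a (\<lambda>k r. h r) n = (h ^^ n) a" for a n and h :: "nat \<Rightarrow> nat"
    by (induction n) auto
  ultimately show ?thesis by simp
qed

section \<open>Decidable predicates and bounded quantifiers\<close>

definition decidable_in :: "nat set \<Rightarrow> (nat \<Rightarrow> bool) \<Rightarrow> bool" where
  "decidable_in A P \<longleftrightarrow> recursive_in A (\<lambda>x. of_bool (P x))"

lemma decidable_comp: "decidable_in A P \<Longrightarrow> recursive_in A g \<Longrightarrow> decidable_in A (\<lambda>x. P (g x))"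
  unfolding decidable_in_def by (rule recursive_comp)

lemma decidable_not [recursive_intros]: "decidable_in A P \<Longrightarrow> decidable_in A (\<lambda>x. \<not> P x)"
proof -
  assume "decidable_in A P"
  then have "recursive_in A (\<lambda>x. 1 - of_bool (P x))"
    unfolding decidable_in_def by (intro recursive_intros)
  also have "(\<lambda>x. 1 - of_bool (P x)) = (\<lambda>x. of_bool (\<not> P x) :: nat)" by auto
  finally show ?thesis unfolding decidable_in_def .
qed

lemma recursive_if [recursive_intros]:
  assumes "decidable_in A P" "recursive_in A f" "recursive_in A g"
  shows "recursive_in A (\<lambda>x. if P x then f x else g x)"
proof -
  \<comment> \<open>A case distinction is a recursion of length 0 or 1, the truth value being the
    counter.\<close>
  have "recursive_in A (\<lambda>x. rec_nat (g x) (\<lambda>k r. f x) (of_bool (P x)))"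
    using assms(1) unfolding decidable_in_def
    by (intro recursive_intros recursive_comp[OF assms(2)] assms(3))
  also have "(\<lambda>x. rec_nat (g x) (\<lambda>k r. f x) (of_bool (P x))) = (\<lambda>x. if P x then f x else g x)"
    by auto
  finally show ?thesis .
qed

lemma decidable_const [recursive_intros]: "decidable_in A (\<lambda>x. c)"
  unfolding decidable_in_def by (rule recursive_const)

lemma decidable_if:
  "decidable_in A P \<Longrightarrow> decidable_in A Q \<Longrightarrow> decidable_in A R \<Longrightarrow>
    decidable_in A (\<lambda>x. if P x then Q x else R x)"
  unfolding decidable_in_def if_distrib[of of_bool]
  by (rule recursive_if) (auto simp: decidable_in_def)

lemma decidable_conj [recursive_intros]:
  "decidable_in A P \<Longrightarrow> decidable_in A Q \<Longrightarrow> decidable_in A (\<lambda>x. P x \<and> Q x)"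
  using decidable_if[of A P Q "\<lambda>_. False"] by (simp add: if_bool_eq_disj decidable_const)

lemma decidable_disj [recursive_intros]:
  "decidable_in A P \<Longrightarrow> decidable_in A Q \<Longrightarrow> decidable_in A (\<lambda>x. P x \<or> Q x)"
  using decidable_not[OF decidable_conj[OF decidable_not[of A P] decidable_not[of A Q]]] by simp

lemma decidable_imp [recursive_intros]:
  "decidable_in A P \<Longrightarrow> decidable_in A Q \<Longrightarrow> decidable_in A (\<lambda>x. P x \<longrightarrow> Q x)"
  unfolding imp_conv_disj by (intro recursive_intros)

lemma decidable_eq_0:
  assumes "recursive_in A f"
  shows "decidable_in A (\<lambda>x. f x = 0)"
proof -
  have "recursive_in A (\<lambda>x. 1 - f x)" by (intro recursive_intros assms)
  also have "(\<lambda>x. 1 - f x) = (\<lambda>x. of_bool (f x = 0))" by auto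
  finally show ?thesis unfolding decidable_in_def .
qed

lemma decidable_le [recursive_intros]:
  assumes "recursive_in A f" "recursive_in A g"
  shows "decidable_in A (\<lambda>x. f x \<le> g x)"
  using decidable_eq_0[OF recursive_diff[OF assms]] by simp

lemma decidable_less [recursive_intros]:
  "recursive_in A f \<Longrightarrow> recursive_in A g \<Longrightarrow> decidable_in A (\<lambda>x. f x < g x)"
  unfolding not_le[symmetric] by (intro recursive_intros)

lemma decidable_eq [recursive_intros]:
  "recursive_in A f \<Longrightarrow> recursive_in A g \<Longrightarrow> decidable_in A (\<lambda>x. f x = g x)"
  unfolding order_eq_iff by (intro recursive_intros)

lemma decidable_mem: "B \<le>\<^sub>T A \<Longrightarrow> recursive_in A f \<Longrightarrow> decidable_in A (\<lambda>x. f x \<in> B)"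
  unfolding turing_reducible_def decidable_in_def
  by (rule recursive_comp[of A "\<lambda>n. of_bool (n \<in> B)"])

text \<open>Bounded counting is a primitive recursion. Bounded quantifiers reduce to comparing such
  a count with 0, and positions in a copy are later approximated by such counts.\<close>

lemma recursive_card [recursive_intros]:
  assumes "recursive_in A f" "decidable_in A (\<lambda>z. P (pfst z) (psnd z))"
  shows "recursive_in A (\<lambda>x. card {y. y < f x \<and> P y x})"
proof -
  have "recursive_in A (\<lambda>z. prod_encode (pfst z, psnd (psnd z)))"
    by (intro recursive_intros)
  from decidable_comp[OF assms(2) this]
  have "decidable_in A (\<lambda>z. P (pfst z) (psnd (psnd z)))"
    by (simp only: pfst_prod_encode psnd_prod_encode)
  then have "recursive_in A (\<lambda>x. rec_nat 0 (\<lambda>k r. if P k x then Suc r else r) (f x))"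
    by (intro recursive_intros assms(1))
  moreover have "rec_nat 0 (\<lambda>k r. if P k x then Suc r else r) n = card {y. y < n \<and> P y x}" for n x
  proof (induction n)
    case (Suc n)
    have "{y. y < Suc n \<and> P y x} = (if P n x then insert n else id) {y. y < n \<and> P y x}"
      by (auto simp: less_Suc_eq)
    then show ?case using Suc by simp
  qed simp
  ultimately show ?thesis by simp
qed

lemma decidable_ex_less [recursive_intros]:
  assumes "recursive_in A f" "decidable_in A (\<lambda>z. P (pfst z) (psnd z))"
  shows "decidable_in A (\<lambda>x. \<exists>y<f x. P y x)"
proof -
  have "decidable_in A (\<lambda>x. \<not> card {y. y < f x \<and> P y x} = 0)"
    using assms by (intro recursive_intros)
  then show ?thesis by simp
qed

lemma decidable_all_less [recursive_intros]:
  assumes "recursive_in A f" "decidable_in A (\<lambda>z. P (pfst z) (psnd z))"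
  shows "decidable_in A (\<lambda>x. \<forall>y<f x. P y x)"
proof -
  have "decidable_in A (\<lambda>x. \<not> (\<exists>y<f x. \<not> P y x))"
    using assms by (intro recursive_intros)
  then show ?thesis by simp
qed

text \<open>The two conclusions are kept apart because \<open>P\<close> may have no witness at
  \<open>x\<close>: the first gives total search functions, and both together give semidecidability.
  As \<open>Mu\<close> looks for a zero, it runs on the negation of \<open>P\<close>.\<close>

lemma search_code:
  assumes "decidable_in A (\<lambda>z. P (pfst z) (psnd z))"
  obtains e where "\<And>x. \<exists>n. P n x \<Longrightarrow> eval A e [x] (LEAST n. P n x)"
    and "\<And>x y. eval A e [x] y \<Longrightarrow> P y x"
proof -
  from decidable_not[OF assms]
  obtain c where c: "\<forall>z. eval A c [z] (of_bool (\<not> P (pfst z) (psnd z)))"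
    unfolding decidable_in_def recursive_in_def ..
  let ?c = "Comp c [pair_code]"
  have ev: "eval A ?c [n, x] (of_bool (\<not> P n x))" for n x
    using eval_Comp1[OF eval_pair_code c[rule_format, of "prod_encode (n, x)"]] by simp
  show ?thesis
  proof (rule that[of "Mu ?c"])
    fix x assume ex: "\<exists>n. P n x"
    show "eval A (Mu ?c) [x] (LEAST n. P n x)"
    proof (rule eval_Mu)
      show "eval A ?c [LEAST n. P n x, x] 0" using ev[of "LEAST n. P n x" x] LeastI_ex[OF ex] by simp
      show "\<forall>m<LEAST n. P n x. \<exists>k. eval A ?c [m, x] (Suc k)"
      proof (intro allI impI exI)
        fix m assume "m < (LEAST n. P n x)"
        then show "eval A ?c [m, x] (Suc 0)" using ev[of m x] not_less_Least by fastforce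
      qed
    qed
  next
    fix x y assume "eval A (Mu ?c) [x] y"
    then have "eval A ?c [y, x] 0" by (rule eval_MuE)
    from eval_deterministic[OF this ev] show "P y x" by simp
  qed
qed

lemma recursive_Least [recursive_intros]:
  assumes "decidable_in A (\<lambda>z. P (pfst z) (psnd z))" "\<And>x. \<exists>n. P n x"
  shows "recursive_in A (\<lambda>x. LEAST n. P n x)"
  using search_code[OF assms(1)] assms(2) unfolding recursive_in_def by metis

lemma ce_set_ex:
  assumes "decidable_in {} (\<lambda>z. P (pfst z) (psnd z))"
  shows "ce_set {x. \<exists>n. P n x}"
proof -
  obtain e where "\<And>x. \<exists>n. P n x \<Longrightarrow> eval {} e [x] (LEAST n. P n x)"
    "\<And>x y. eval {} e [x] y \<Longrightarrow> P y x"
    using search_code[OF assms] by blast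
  then have "{x. \<exists>n. P n x} = {x. \<exists>y. eval {} e [x] y}" by blast
  then show ?thesis unfolding ce_set_def by blast
qed

section \<open>Turing reducibility\<close>

primrec subst_oracle :: "code \<Rightarrow> code \<Rightarrow> code" where
  "subst_oracle e Zero = Zero"
| "subst_oracle e Succ = Succ"
| "subst_oracle e (Proj i) = Proj i"
| "subst_oracle e Oracle = e"
| "subst_oracle e (Comp f gs) = Comp (subst_oracle e f) (map (subst_oracle e) gs)"
| "subst_oracle e (PrimRec f g) = PrimRec (subst_oracle e f) (subst_oracle e g)"
| "subst_oracle e (Mu f) = Mu (subst_oracle e f)"

text \<open>Each oracle query is answered by a program that decides \<open>B\<close>; transitivity
  of reducibility rests on this.\<close>

lemma eval_subst_oracle:
  assumes "\<And>x. eval A e [x] (of_bool (x \<in> B))" "eval B c xs y"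
  shows "eval A (subst_oracle e c) xs y"
  using assms(2)
proof (induction rule: eval.induct)
  case (eval_Comp xs gs ys f z)
  then show ?case
    by (auto simp: list_all2_map1 intro!: eval.eval_Comp[of _ xs _ ys] elim: list_all2_mono)
next
  case (eval_Mu f n xs)
  then show ?case by (auto intro!: eval.eval_Mu)
qed (auto simp: assms(1) intro: eval.intros)

lemma recursive_in_trans: "B \<le>\<^sub>T A \<Longrightarrow> recursive_in B f \<Longrightarrow> recursive_in A f"
  unfolding turing_reducible_def recursive_in_def by (meson eval_subst_oracle)

lemma recursive_in_empty: "recursive_in {} f \<Longrightarrow> recursive_in A f"
  by (rule recursive_in_trans[of "{}"]) (simp_all add: turing_reducible_def recursive_const)

lemma decidable_in_empty: "decidable_in {} P \<Longrightarrow> decidable_in A P"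
  unfolding decidable_in_def by (rule recursive_in_empty)

lemma turing_reducible_iff: "B \<le>\<^sub>T A \<longleftrightarrow> decidable_in A (\<lambda>x. x \<in> B)"
  unfolding turing_reducible_def decidable_in_def ..

lemma turing_reducible_refl: "A \<le>\<^sub>T A"
  unfolding turing_reducible_def recursive_in_def by (blast intro: eval_Oracle)

lemma turing_reducible_trans: "C \<le>\<^sub>T B \<Longrightarrow> B \<le>\<^sub>T A \<Longrightarrow> C \<le>\<^sub>T A"
  unfolding turing_reducible_def[of C] by (rule recursive_in_trans)

lemma turing_degree_eqI: "A \<le>\<^sub>T B \<Longrightarrow> B \<le>\<^sub>T A \<Longrightarrow> turing_degree A = turing_degree B"
  unfolding turing_degree_def by (blast intro: turing_reducible_trans)

section \<open>A decidable halting predicate\<close>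

definition hdn :: "nat \<Rightarrow> nat" where "hdn l = pfst (l - 1)"
text \<open>The code 0 is the empty list and any other code is one more than a pair, hence the
  predecessor. The tail of 0 is 0 again, so \<open>dropn\<close> may run past the end of a
  list.\<close>

definition tln :: "nat \<Rightarrow> nat" where "tln l = psnd (l - 1)"
definition consn :: "nat \<Rightarrow> nat \<Rightarrow> nat" where "consn x l = Suc (prod_encode (x, l))"
definition dropn :: "nat \<Rightarrow> nat \<Rightarrow> nat" where "dropn i l = (tln ^^ i) l"

lemma list_encode_eq_0_iff [simp]: "list_encode xs = 0 \<longleftrightarrow> xs = []"
  by (cases xs) auto

lemma hdn_list_encode [simp]: "xs \<noteq> [] \<Longrightarrow> hdn (list_encode xs) = hd xs"
  by (cases xs) (auto simp: hdn_def)

lemma tln_list_encode [simp]: "tln (list_encode xs) = list_encode (tl xs)"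
proof (cases xs)
  case Nil
  have "psnd (prod_encode (0, 0)) = 0" by (rule psnd_prod_encode)
  then show ?thesis using Nil by (simp add: tln_def prod_encode_def)
qed (simp add: tln_def)

lemma consn_list_encode [simp]: "consn x (list_encode xs) = list_encode (x # xs)"
  by (simp add: consn_def)

lemma dropn_list_encode [simp]: "dropn i (list_encode xs) = list_encode (drop i xs)"
  by (induction i) (auto simp: dropn_def drop_Suc tl_drop)

lemma hdn_dropn_list_encode [simp]: "i < length xs \<Longrightarrow> hdn (list_encode (drop i xs)) = xs ! i"
  by (simp add: hd_drop_conv_nth)

lemma length_le_list_encode: "length xs \<le> list_encode xs"
proof (induction xs)
  case (Cons x xs)
  then show ?case using le_prod_encode_2[of "list_encode xs" x] by simp
qed simp

lemma less_list_encode: "x \<in> set xs \<Longrightarrow> x < list_encode xs"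
proof (induction xs)
  case (Cons a xs)
  then show ?case
    using le_prod_encode_2[of "list_encode xs" a] le_prod_encode_1[of a "list_encode xs"]
    by fastforce
qed simp

text \<open>A list is no longer than its code, so membership becomes a bounded search and is
  therefore decidable.\<close>

lemma mem_list_decode_iff:
  "x \<in> set (list_decode l) \<longleftrightarrow> (\<exists>i<l. dropn i l \<noteq> 0 \<and> hdn (dropn i l) = x)"
proof -
  define xs where "xs = list_decode l"
  have l: "l = list_encode xs" by (simp add: xs_def)
  have "x \<in> set xs \<longleftrightarrow> (\<exists>i<list_encode xs. i < length xs \<and> hdn (list_encode (drop i xs)) = x)"
  proof -
    have "x \<in> set xs \<longleftrightarrow> (\<exists>i. i < length xs \<and> hdn (list_encode (drop i xs)) = x)"
      by (auto simp: in_set_conv_nth hd_drop_conv_nth)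
    then show ?thesis using less_le_trans[OF _ length_le_list_encode[of xs]] by blast
  qed
  then show ?thesis unfolding xs_def[symmetric] unfolding l by (simp add: not_le)
qed

lemma recursive_hdn [recursive_intros]:
  "recursive_in A f \<Longrightarrow> recursive_in A (\<lambda>x. hdn (f x))"
  unfolding hdn_def by (intro recursive_intros)

lemma recursive_tln [recursive_intros]:
  "recursive_in A f \<Longrightarrow> recursive_in A (\<lambda>x. tln (f x))"
  unfolding tln_def by (intro recursive_intros)

lemma recursive_consn [recursive_intros]:
  "recursive_in A f \<Longrightarrow> recursive_in A g \<Longrightarrow> recursive_in A (\<lambda>x. consn (f x) (g x))"
  unfolding consn_def by (intro recursive_intros)

lemma recursive_dropn [recursive_intros]:
  "recursive_in A f \<Longrightarrow> recursive_in A g \<Longrightarrow> recursive_in A (\<lambda>x. dropn (f x) (g x))"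
  unfolding dropn_def by (intro recursive_intros)

lemma decidable_mem_list_decode [recursive_intros]:
  assumes "recursive_in A f" "recursive_in A l"
  shows "decidable_in A (\<lambda>x. f x \<in> set (list_decode (l x)))"
proof -
  have "decidable_in A (\<lambda>z. pfst z \<in> set (list_decode (psnd z)))"
    unfolding mem_list_decode_iff by (intro recursive_intros)
  from decidable_comp[OF this recursive_pair[OF assms]] show ?thesis by simp
qed

lemma decidable_ex_bounded:
  assumes "recursive_in A f" "\<And>x y. P y x \<Longrightarrow> y < f x" "decidable_in A (\<lambda>z. P (pfst z) (psnd z))"
  shows "decidable_in A (\<lambda>x. \<exists>y. P y x)"
proof -
  have "(\<exists>y. P y x) \<longleftrightarrow> (\<exists>y<f x. P y x)" for x using assms(2) by blast
  then show ?thesis using decidable_ex_less[OF assms(1,3)] by simp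
qed

section \<open>Derivations of oracle-free evaluations as lists of judgments\<close>

primrec num :: "code \<Rightarrow> nat" where
  "num Zero = prod_encode (0, 0)"
| "num Succ = prod_encode (1, 0)"
| "num (Proj i) = prod_encode (2, i)"
| "num Oracle = prod_encode (3, 0)"
| "num (Comp f gs) = prod_encode (4, prod_encode (num f, list_encode (map num gs)))"
| "num (PrimRec f g) = prod_encode (5, prod_encode (num f, num g))"
| "num (Mu f) = prod_encode (6, num f)"

text \<open>The number of the judgment that the code numbered \<open>e\<close> takes the value
  \<open>y\<close> on the list coded by \<open>xs\<close>.\<close>

definition jud :: "nat \<Rightarrow> nat \<Rightarrow> nat \<Rightarrow> nat" where
  "jud e xs y = prod_encode (e, prod_encode (xs, y))"

lemma recursive_jud [recursive_intros]:
  "recursive_in A f \<Longrightarrow> recursive_in A g \<Longrightarrow> recursive_in A h \<Longrightarrow>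
    recursive_in A (\<lambda>x. jud (f x) (g x) (h x))"
  unfolding jud_def by (intro recursive_intros)

lemma jud_mem_list_decode:
  assumes "jud e xs y \<in> set (list_decode l)"
  shows "xs < l" "y < l"
proof -
  have "jud e xs y < l" using less_list_encode[OF assms] by simp
  moreover have "xs \<le> jud e xs y" "y \<le> jud e xs y"
    unfolding jud_def by (meson le_prod_encode_1 le_prod_encode_2 le_trans)+
  ultimately show "xs < l" "y < l" by auto
qed

text \<open>\<open>justified S e xs y\<close>: the judgment that the oracle-free code \<open>e\<close> takes the value \<open>y\<close>
  on \<open>xs\<close> follows by one rule of \<open>eval\<close> from the judgments in \<open>S\<close>.\<close>

definition justified :: "nat set \<Rightarrow> nat \<Rightarrow> nat \<Rightarrow> nat \<Rightarrow> bool" where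
  "justified S e xs y \<longleftrightarrow>
    pfst e = 0 \<and> y = 0 \<or>
    pfst e = 1 \<and> xs \<noteq> 0 \<and> tln xs = 0 \<and> y = Suc (hdn xs) \<or>
    pfst e = 2 \<and> dropn (psnd e) xs \<noteq> 0 \<and> y = hdn (dropn (psnd e) xs) \<or>
    pfst e = 3 \<and> xs \<noteq> 0 \<and> tln xs = 0 \<and> y = 0 \<or>
    pfst e = 4 \<and> (\<exists>ys. jud (pfst (psnd e)) ys y \<in> S \<and>
      (\<forall>i<Suc (ys + psnd (psnd e)). dropn i ys = 0 \<longleftrightarrow> dropn i (psnd (psnd e)) = 0) \<and>
      (\<forall>i<ys. dropn i ys \<noteq> 0 \<longrightarrow> jud (hdn (dropn i (psnd (psnd e)))) xs (hdn (dropn i ys)) \<in> S)) \<or>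
    pfst e = 5 \<and> xs \<noteq> 0 \<and> hdn xs = 0 \<and> jud (pfst (psnd e)) (tln xs) y \<in> S \<or>
    pfst e = 5 \<and> xs \<noteq> 0 \<and> hdn xs \<noteq> 0 \<and> (\<exists>r. jud e (consn (hdn xs - 1) (tln xs)) r \<in> S \<and>
      jud (psnd (psnd e)) (consn (hdn xs - 1) (consn r (tln xs))) y \<in> S) \<or>
    pfst e = 6 \<and> jud (psnd e) (consn y xs) 0 \<in> S \<and>
      (\<forall>m<y. \<exists>k. jud (psnd e) (consn m xs) (Suc k) \<in> S)"

text \<open>The set of premises occurs only positively in \<open>justified\<close>.\<close>

lemma justified_mono: "S \<subseteq> S' \<Longrightarrow> justified S e xs y \<Longrightarrow> justified S' e xs y"
proof -
  assume "S \<subseteq> S'" "justified S e xs y"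
  then have *: "j \<in> S \<longrightarrow> j \<in> S'" for j by blast
  have "justified S e xs y \<longrightarrow> justified S' e xs y"
    unfolding justified_def
    by (intro disj_mono conj_mono ex_mono all_mono imp_mono * imp_refl)
  with \<open>justified S e xs y\<close> show ?thesis by simp
qed

lemma decidable_iff [recursive_intros]:
  "decidable_in A P \<Longrightarrow> decidable_in A Q \<Longrightarrow> decidable_in A (\<lambda>x. P x \<longleftrightarrow> Q x)"
  unfolding iff_conv_conj_imp by (intro recursive_intros)

lemma decidable_justified [recursive_intros]:
  assumes "recursive_in A l" "recursive_in A e" "recursive_in A xs" "recursive_in A y"
  shows "decidable_in A (\<lambda>x. justified (set (list_decode (l x))) (e x) (xs x) (y x))"
proof -
  have "decidable_in A (\<lambda>z. justified (set (list_decode (pfst z)))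
      (pfst (psnd z)) (pfst (psnd (psnd z))) (psnd (psnd (psnd z))))"
    unfolding justified_def
    apply (intro recursive_intros)
    \<comment> \<open>The witnesses \<open>ys\<close>, \<open>r\<close> and \<open>k\<close> of the
      unbounded existentials all occur in a judgment from the list, so they lie below the code of
      that list.\<close>
    apply (rule decidable_ex_bounded[of _ pfst], intro recursive_intros)
    apply (blast dest: jud_mem_list_decode)
    apply (intro recursive_intros)
    apply (rule decidable_ex_bounded[of _ pfst], intro recursive_intros)
    apply (blast dest: jud_mem_list_decode)
    apply (intro recursive_intros)
    apply (rule decidable_ex_bounded[of _ "\<lambda>x. pfst (psnd x)"], intro recursive_intros)
    apply (meson jud_mem_list_decode Suc_lessD)
    apply (intro recursive_intros)
    done
  from decidable_comp[OF this recursive_pair[OF assms(1) recursive_pair[OF assms(2)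
    recursive_pair[OF assms(3,4)]]]]
  show ?thesis by simp
qed

text \<open>A derivation is listed backwards: the premises of a judgment stand behind it.\<close>

primrec valid :: "nat list \<Rightarrow> bool" where
  "valid [] \<longleftrightarrow> True"
| "valid (j # js) \<longleftrightarrow>
    justified (set js) (pfst j) (pfst (psnd j)) (psnd (psnd j)) \<and> valid js"

lemma valid_iff:
  "valid js \<longleftrightarrow> (\<forall>i<length js. justified (set (drop (Suc i) js))
    (pfst (js ! i)) (pfst (psnd (js ! i))) (psnd (psnd (js ! i))))"
  by (induction js) (auto simp: All_less_Suc2)

text \<open>Replaces the recursion over the list by a bounded quantifier over positions, to which
  the closure rules apply.\<close>

lemma valid_list_decode_iff:
  "valid (list_decode l) \<longleftrightarrow> (\<forall>i<l. dropn i l \<noteq> 0 \<longrightarrow>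
    justified (set (list_decode (dropn (Suc i) l))) (pfst (hdn (dropn i l)))
      (pfst (psnd (hdn (dropn i l)))) (psnd (psnd (hdn (dropn i l)))))"
proof -
  define js where "js = list_decode l"
  have l: "l = list_encode js" by (simp add: js_def)
  have *: "i < list_encode js \<and> \<not> length js \<le> i \<longleftrightarrow> i < length js" for i
    using length_le_list_encode[of js] by linarith
  have "(\<forall>i<list_encode js. \<not> length js \<le> i \<longrightarrow> Q i) \<longleftrightarrow> (\<forall>i<length js. Q i)" for Q
    using * by blast
  then show ?thesis unfolding js_def[symmetric] valid_iff unfolding l
    by (simp add: hd_drop_conv_nth)
qed

lemma decidable_valid [recursive_intros]:
  assumes "recursive_in A f"
  shows "decidable_in A (\<lambda>x. valid (list_decode (f x)))"
proof -
  have "decidable_in A (\<lambda>x. valid (list_decode x))"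
    unfolding valid_list_decode_iff by (intro recursive_intros)
  from decidable_comp[OF this assms] show ?thesis .
qed

section \<open>Soundness and completeness of derivations\<close>

lemma eval_if_justified:
  assumes "justified S (num c) (list_encode xs) y"
    and S: "\<And>c xs y. jud (num c) (list_encode xs) y \<in> S \<Longrightarrow> eval {} c xs y"
  shows "eval {} c xs y"
proof (cases c)
  case Zero
  then show ?thesis using assms(1) by (simp add: justified_def eval_Zero)
next
  case Succ
  with assms(1) obtain x where "xs = [x]" "y = Suc x"
    by (cases xs) (auto simp: justified_def simp del: list_encode.simps)
  then show ?thesis using Succ by (simp add: eval_Succ)
next
  case (Proj i)
  with assms(1) have i: "i < length xs" by (simp add: justified_def)
  with Proj assms(1) have "y = xs ! i" by (simp add: justified_def hd_drop_conv_nth)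
  then show ?thesis using i Proj by (simp add: eval_Proj)
next
  case Oracle
  with assms(1) obtain x where "xs = [x]" "y = 0"
    by (cases xs) (auto simp: justified_def simp del: list_encode.simps)
  then show ?thesis using Oracle eval_Oracle[of "{}" x] by simp
next
  case (Comp f gs)
  with assms(1) have "\<exists>l. jud (num f) l y \<in> S \<and>
    (\<forall>i<Suc (l + list_encode (map num gs)).
      dropn i l = 0 \<longleftrightarrow> dropn i (list_encode (map num gs)) = 0) \<and>
    (\<forall>i<l. dropn i l \<noteq> 0 \<longrightarrow>
      jud (hdn (dropn i (list_encode (map num gs)))) (list_encode xs) (hdn (dropn i l)) \<in> S)"
    by (simp add: justified_def del: dropn_list_encode)
  then obtain l where l: "jud (num f) l y \<in> S"
    "\<forall>i<Suc (l + list_encode (map num gs)). dropn i l = 0 \<longleftrightarrow> dropn i (list_encode (map num gs)) = 0"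
    "\<forall>i<l. dropn i l \<noteq> 0 \<longrightarrow>
      jud (hdn (dropn i (list_encode (map num gs)))) (list_encode xs) (hdn (dropn i l)) \<in> S"
    by blast
  define ys where "ys = list_decode l"
  have lys: "l = list_encode ys" by (simp add: ys_def)
  \<comment> \<open>The clause for composition compares the two lists only at indices up to the sum
    of their codes. This covers both lengths, so the lists are equally long.\<close>
  have bound: "i < Suc (l + list_encode (map num gs))" if "i \<le> length ys \<or> i \<le> length gs" for i
    using that length_le_list_encode[of ys] length_le_list_encode[of "map num gs"] lys by auto
  have "length ys \<le> i \<longleftrightarrow> length gs \<le> i" if "i \<le> length ys \<or> i \<le> length gs" for i
    using l(2) bound[OF that] lys by simp
  then have len: "length ys = length gs" by (meson le_antisym order_refl)
  have "list_all2 (\<lambda>g y. eval {} g xs y) gs ys"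
  proof (rule list_all2_all_nthI)
    fix i assume i: "i < length gs"
    then have "i < l" using len lys length_le_list_encode[of ys] by simp
    then have "jud (num (gs ! i)) (list_encode xs) (ys ! i) \<in> S"
      using l(3)[rule_format, of i] i len lys by (simp add: hd_drop_conv_nth)
    then show "eval {} (gs ! i) xs (ys ! i)" by (rule S)
  qed (simp add: len)
  moreover have "eval {} f ys y" using l(1) lys S by simp
  ultimately show ?thesis unfolding Comp by (rule eval_Comp)
next
  case (PrimRec f g)
  have "xs \<noteq> []" using assms(1) PrimRec by (auto simp: justified_def)
  then obtain n zs where xs: "xs = n # zs" by (cases xs) auto
  show ?thesis
  proof (cases n)
    case 0
    then have "jud (num f) (list_encode zs) y \<in> S"
      using assms(1) PrimRec xs by (auto simp: justified_def simp del: list_encode.simps)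
    then show ?thesis unfolding PrimRec xs 0 by (intro eval_PrimRec_0 S)
  next
    case (Suc m)
    then obtain r where "jud (num c) (list_encode (m # zs)) r \<in> S"
      "jud (num g) (list_encode (m # r # zs)) y \<in> S"
      using assms(1) PrimRec xs by (auto simp: justified_def simp del: list_encode.simps)
    then show ?thesis unfolding PrimRec xs Suc
      using S[of c] S[of g] PrimRec by (blast intro: eval_PrimRec_Suc)
  qed
next
  case (Mu f)
  then have "jud (num f) (list_encode (y # xs)) 0 \<in> S"
    "\<forall>m<y. \<exists>k. jud (num f) (list_encode (m # xs)) (Suc k) \<in> S"
    using assms(1) by (auto simp: justified_def simp del: list_encode.simps)
  then show ?thesis unfolding Mu using S by (blast intro: eval_Mu)
qed

lemma eval_if_valid:
  "valid js \<Longrightarrow> jud (num c) (list_encode xs) y \<in> set js \<Longrightarrow> eval {} c xs y"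
proof (induction js arbitrary: c xs y)
  case (Cons j js)
  show ?case
  proof (cases "j = jud (num c) (list_encode xs) y")
    case True
    then have "justified (set js) (num c) (list_encode xs) y"
      using Cons.prems(1) by (simp add: jud_def)
    then show ?thesis using Cons by (auto intro: eval_if_justified)
  qed (use Cons in auto)
qed simp

lemma valid_append: "valid js \<Longrightarrow> valid ks \<Longrightarrow> valid (js @ ks)"
  by (induction js) (auto elim: justified_mono[rotated])

lemma valid_finite:
  assumes "finite X" "\<forall>j\<in>X. \<exists>js. valid js \<and> j \<in> set js"
  shows "\<exists>js. valid js \<and> X \<subseteq> set js"
  using assms
proof (induction X)
  case empty
  show ?case by (rule exI[of _ "[]"]) simp
next
  case (insert j X)
  then obtain js ks where "valid js" "X \<subseteq> set js" "valid ks" "j \<in> set ks" by auto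
  then show ?case by (intro exI[of _ "js @ ks"]) (auto intro: valid_append)
qed

text \<open>The premises may come from different derivations; as there are finitely many, these are
  concatenated and the conclusion is put in front.\<close>

lemma derivable_step:
  assumes "finite X" "\<forall>j\<in>X. \<exists>js. valid js \<and> j \<in> set js" "justified X e xs y"
  shows "\<exists>js. valid js \<and> jud e xs y \<in> set js"
proof -
  obtain js where js: "valid js" "X \<subseteq> set js" using valid_finite[OF assms(1,2)] by blast
  then have "valid (jud e xs y # js)" using justified_mono[OF js(2) assms(3)] by (simp add: jud_def)
  then show ?thesis by (intro exI[of _ "jud e xs y # js"]) simp
qed

lemma derivable_if_eval:
  "eval {} c xs y \<Longrightarrow> \<exists>js. valid js \<and> jud (num c) (list_encode xs) y \<in> set js"
proof (induction rule: eval.induct)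
  case (eval_Zero xs)
  show ?case by (rule derivable_step[of "{}"]) (auto simp: justified_def)
next
  case (eval_Succ x)
  show ?case by (rule derivable_step[of "{}"]) (auto simp: justified_def simp del: list_encode.simps)
next
  case (eval_Proj i xs)
  then show ?case
    by (intro derivable_step[of "{}"])
      (auto simp: justified_def hd_drop_conv_nth simp del: list_encode.simps)
next
  case (eval_Oracle x)
  show ?case by (rule derivable_step[of "{}"]) (auto simp: justified_def simp del: list_encode.simps)
next
  case (eval_Comp xs gs ys f z)
  let ?X = "insert (jud (num f) (list_encode ys) z)
    ((\<lambda>i. jud (num (gs ! i)) (list_encode xs) (ys ! i)) ` {..<length gs})"
  have len: "length gs = length ys" using eval_Comp.IH(1) by (auto dest: list_all2_lengthD)
  show ?case
  proof (rule derivable_step[of ?X])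
    show "\<forall>j\<in>?X. \<exists>js. valid js \<and> j \<in> set js"
      using eval_Comp.IH by (auto simp: list_all2_conv_all_nth)
    have "jud (hdn (dropn i (list_encode (map num gs)))) (list_encode xs)
        (hdn (dropn i (list_encode ys))) \<in> ?X" if "dropn i (list_encode ys) \<noteq> 0" for i
    proof -
      from that have "i < length ys" by simp
      then show ?thesis using len by (auto simp: hd_drop_conv_nth)
    qed
    \<comment> \<open>The fifth disjunct is the one for composition, with \<open>ys\<close> as the
      list of intermediate values.\<close>
    then show "justified ?X (num (Comp f gs)) (list_encode xs) z"
      using len unfolding justified_def num.simps pfst_prod_encode psnd_prod_encode
      by (intro disjI2[OF disjI2[OF disjI2[OF disjI2[OF disjI1]]]] conjI refl
          exI[of _ "list_encode ys"]) auto
  qed simp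
next
  case (eval_PrimRec_0 f xs y g)
  then show ?case
    by (intro derivable_step[of "{jud (num f) (list_encode xs) y}"])
      (auto simp: justified_def simp del: list_encode.simps)
next
  case (eval_PrimRec_Suc f g n xs r y)
  then show ?case
    by (intro derivable_step[of "{jud (num (PrimRec f g)) (list_encode (n # xs)) r,
        jud (num g) (list_encode (n # r # xs)) y}"])
      (auto simp: justified_def simp del: list_encode.simps)
next
  case (eval_Mu f n xs)
  from eval_Mu.IH(2) obtain k where k: "\<And>m. m < n \<Longrightarrow>
      \<exists>js. valid js \<and> jud (num f) (list_encode (m # xs)) (Suc (k m)) \<in> set js"
    by metis
  let ?X = "insert (jud (num f) (list_encode (n # xs)) 0)
    ((\<lambda>m. jud (num f) (list_encode (m # xs)) (Suc (k m))) ` {..<n})"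
  show ?case
    by (rule derivable_step[of ?X]) (use eval_Mu.IH(1) k in
      \<open>auto simp: justified_def simp del: list_encode.simps\<close>)
qed

text \<open>A stage is itself the code of a derivation, so the predicate need not be monotone in
  \<open>s\<close>. The bound on \<open>y\<close> loses nothing, since a value is smaller than the
  code of a list that contains its judgment. The code of \<open>[x]\<close> is
  \<open>consn x 0\<close>.\<close>

definition halts_by :: "nat \<Rightarrow> nat \<Rightarrow> nat \<Rightarrow> bool" where
  "halts_by s e x \<longleftrightarrow> valid (list_decode s) \<and>
    (\<exists>y<s. jud e (consn x 0) y \<in> set (list_decode s))"

lemma decidable_halts_by [recursive_intros]:
  assumes "recursive_in A f" "recursive_in A g" "recursive_in A h"
  shows "decidable_in A (\<lambda>x. halts_by (f x) (g x) (h x))"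
proof -
  have "decidable_in A (\<lambda>z. halts_by (pfst z) (pfst (psnd z)) (psnd (psnd z)))"
    unfolding halts_by_def by (intro recursive_intros)
  from decidable_comp[OF this recursive_pair[OF assms(1) recursive_pair[OF assms(2,3)]]]
  show ?thesis by simp
qed

lemma ex_halts_by_iff: "(\<exists>s. halts_by s (num c) x) \<longleftrightarrow> (\<exists>y. eval {} c [x] y)"
proof
  assume "\<exists>s. halts_by s (num c) x"
  then obtain s y where "valid (list_decode s)" "jud (num c) (list_encode [x]) y \<in> set (list_decode s)"
    unfolding halts_by_def consn_def by auto
  then show "\<exists>y. eval {} c [x] y" using eval_if_valid by blast
next
  assume "\<exists>y. eval {} c [x] y"
  then obtain y js where js: "valid js" "jud (num c) (list_encode [x]) y \<in> set js"
    using derivable_if_eval by blast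
  then have "y < list_encode js" using jud_mem_list_decode(2)[of _ _ y "list_encode js"] by simp
  then show "\<exists>s. halts_by s (num c) x"
    using js unfolding halts_by_def consn_def by (intro exI[of _ "list_encode js"]) auto
qed

text \<open>Diagonalization: a decision procedure would yield a code \<open>c\<close> that converges
  on \<open>x\<close> exactly if program \<open>x\<close> diverges on \<open>x\<close>, which is
  contradictory at \<open>x = num c\<close>.\<close>

lemma undecidable_halting: "\<not> decidable_in {} (\<lambda>e. \<exists>s. halts_by s e e)"
proof
  assume "decidable_in {} (\<lambda>e. \<exists>s. halts_by s e e)"
  \<comment> \<open>The searched predicate ignores the search variable, so the search stops at once
    or never.\<close>
  then have "decidable_in {} (\<lambda>z. \<not> (\<exists>s. halts_by s (psnd z) (psnd z)))"
    by (intro decidable_not recursive_intros decidable_comp[of _ "\<lambda>e. \<exists>s. halts_by s e e" psnd])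
  then obtain c where "\<And>x. \<exists>n::nat. \<not> (\<exists>s. halts_by s x x) \<Longrightarrow>
      eval {} c [x] (LEAST n::nat. \<not> (\<exists>s. halts_by s x x))"
    "\<And>x y. eval {} c [x] y \<Longrightarrow> \<not> (\<exists>s. halts_by s x x)"
    by (rule search_code[of "{}" "\<lambda>n x. \<not> (\<exists>s. halts_by s x x)"]) blast
  then show False using ex_halts_by_iff[of c "num c"] by blast
qed

lemma decidable_comp2:
  assumes "decidable_in A (\<lambda>z. P (pfst z) (psnd z))" "recursive_in A f" "recursive_in A g"
  shows "decidable_in A (\<lambda>x. P (f x) (g x))"
  using decidable_comp[OF assms(1) recursive_pair[OF assms(2,3)]] by simp

text \<open>Only the least halting stage counts as the stage of entry, which makes it unique. This
  uniqueness later makes \<open>key\<close> finite-to-one.\<close>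

lemma ce_set_stages:
  assumes "ce_set B"
  obtains Q where "decidable_in {} (\<lambda>z. Q (pfst z) (psnd z))" "\<And>x. x \<in> B \<longleftrightarrow> (\<exists>s. Q s x)"
    "\<And>s t x. Q s x \<Longrightarrow> Q t x \<Longrightarrow> s = t"
proof -
  obtain c where c: "B = {x. \<exists>y. eval {} c [x] y}" using assms unfolding ce_set_def by blast
  define Q where "Q s x \<longleftrightarrow> halts_by s (num c) x \<and> (\<forall>t<s. \<not> halts_by t (num c) x)" for s x
  have "decidable_in {} (\<lambda>z. Q (pfst z) (psnd z))"
    unfolding Q_def by (intro recursive_intros)
  moreover have "x \<in> B \<longleftrightarrow> (\<exists>s. Q s x)" for x
    unfolding c Q_def using ex_halts_by_iff[of c x] exists_least_iff[of "\<lambda>s. halts_by s (num c) x"]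
    by simp
  moreover have "s = t" if "Q s x" "Q t x" for s t x
    using that unfolding Q_def by (meson linorder_neqE_nat)
  ultimately show ?thesis by (rule that)
qed

lemma ex_undecidable_ce_set: "\<exists>K. ce_set K \<and> \<not> decidable_in {} (\<lambda>x. x \<in> K)"
proof -
  have "decidable_in {} (\<lambda>z. halts_by (pfst z) (psnd z) (psnd z))" by (intro recursive_intros)
  then have "ce_set {e. \<exists>s. halts_by s e e}" by (rule ce_set_ex)
  with undecidable_halting show ?thesis by (intro exI[of _ "{e. \<exists>s. halts_by s e e}"]) simp
qed

section \<open>Coding an enumeration into a finite-to-one function\<close>

text \<open>\<open>Q s x\<close> stands for: \<open>x\<close> enters the enumerated set at stage
  \<open>s\<close>. The locale serves both the set coded into the function and the set whose degree
  a copy is to realize.\<close>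

locale enumeration =
  fixes Q :: "nat \<Rightarrow> nat \<Rightarrow> bool"
  assumes decidable_Q: "decidable_in {} (\<lambda>z. Q (pfst z) (psnd z))"
    and Q_unique: "Q s x \<Longrightarrow> Q t x \<Longrightarrow> s = t"
begin

definition key :: "nat \<Rightarrow> nat" where
  "key m = (if Q (psnd m) (pfst m) then pfst m else m)"

lemma decidable_Q_comp:
  "recursive_in A f \<Longrightarrow> recursive_in A g \<Longrightarrow> decidable_in A (\<lambda>x. Q (f x) (g x))"
  by (rule decidable_comp2[OF decidable_in_empty[OF decidable_Q]])

lemma recursive_key: "recursive_in A f \<Longrightarrow> recursive_in A (\<lambda>x. key (f x))"
  unfolding key_def by (intro recursive_intros decidable_Q_comp)

lemma key_le: "key m \<le> m"
  unfolding key_def using pfst_le by simp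

lemma key_prod_encode: "Q s x \<Longrightarrow> key (prod_encode (x, s)) = x"
  unfolding key_def by simp

lemma key_cases:
  obtains "Q (psnd m) (key m)" "m = prod_encode (key m, psnd m)" | "key m = m"
  using prod_encode_pfst_psnd[of m] unfolding key_def by (cases "Q (psnd m) (pfst m)") auto

text \<open>A number with key at most \<open>k\<close> either is its own key or pairs some
  \<open>x \<le> k\<close> with the unique stage at which \<open>x\<close> enters.\<close>

lemma finite_key_le: "finite {m. key m \<le> k}"
proof (rule finite_subset)
  show "{m. key m \<le> k} \<subseteq> {..k} \<union> (\<lambda>x. prod_encode (x, THE s. Q s x)) ` {..k}"
  proof
    fix m assume "m \<in> {m. key m \<le> k}"
    then have m: "key m \<le> k" by simp
    show "m \<in> {..k} \<union> (\<lambda>x. prod_encode (x, THE s. Q s x)) ` {..k}"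
    proof (cases m rule: key_cases)
      case 1
      then have "(THE s. Q s (key m)) = psnd m" using Q_unique by blast
      then show ?thesis using 1(2) m by (intro UnI2 image_eqI[of _ _ "key m"]) auto
    qed (use m in auto)
  qed
qed simp

lemma ex_key_greater: "\<exists>m. k < key m"
proof (rule ccontr)
  assume "\<not> (\<exists>m. k < key m)"
  then have "{m. key m \<le> k} = UNIV" by (auto simp: not_less)
  then show False using finite_key_le[of k] by simp
qed

end

section \<open>Positions in a computable copy\<close>

lemma recursive_half [recursive_intros]:
  assumes "recursive_in A f"
  shows "recursive_in A (\<lambda>x. f x div 2)"
proof -
  have "recursive_in A (\<lambda>x. LEAST k. x < Suc (Suc (k + k)))"
  proof (intro recursive_intros)
    show "\<exists>k. x < Suc (Suc (k + k))" for x by (rule exI[of _ x]) simp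
  qed
  moreover have "(LEAST k. x < Suc (Suc (k + k))) = x div 2" for x
    by (rule Least_equality) linarith+
  ultimately have "recursive_in A (\<lambda>x. x div 2)" by simp
  from recursive_comp[OF this assms] show ?thesis .
qed

lemma decidable_even [recursive_intros]:
  assumes "recursive_in A f"
  shows "decidable_in A (\<lambda>x. even (f x))"
proof -
  have "decidable_in A (\<lambda>x. f x = f x div 2 + f x div 2)" by (intro recursive_intros assms)
  moreover have "n = n div 2 + n div 2 \<longleftrightarrow> even n" for n :: nat by presburger
  ultimately show ?thesis by simp
qed

locale copy =
  fixes R :: "(nat \<times> nat) set" and \<phi> :: "nat \<Rightarrow> nat"
  assumes iso: "iso_from_omega R \<phi>" and computable: "computable_set (prod_encode ` R)"
begin

definition pos :: "nat \<Rightarrow> nat" where "pos = inv \<phi>"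

lemma bij_phi: "bij \<phi>"
  using iso unfolding iso_from_omega_def by simp

lemma pos_phi [simp]: "pos (\<phi> n) = n"
  unfolding pos_def using bij_phi by (simp add: bij_is_inj)

lemma phi_pos [simp]: "\<phi> (pos x) = x"
  unfolding pos_def using bij_phi by (simp add: bij_is_surj surj_f_inv_f)

lemma mem_R_iff: "(x, y) \<in> R \<longleftrightarrow> pos x < pos y"
  using iso phi_pos unfolding iso_from_omega_def by metis

lemma decidable_R:
  assumes "recursive_in A f" "recursive_in A g"
  shows "decidable_in A (\<lambda>x. (f x, g x) \<in> R)"
proof -
  have "decidable_in {} (\<lambda>z. z \<in> prod_encode ` R)"
    using computable unfolding computable_set_def computable_def decidable_in_def .
  from decidable_comp[OF decidable_in_empty[OF this] recursive_pair[OF assms]]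
  show ?thesis by (simp add: inj_image_mem_iff[OF inj_prod_encode])
qed

text \<open>The stage \<open>s\<close> approximation from below to the position of
  \<open>x\<close>.\<close>

definition seen :: "nat \<Rightarrow> nat \<Rightarrow> nat" where
  "seen s x = card {y. y < s \<and> (y, x) \<in> R}"

lemma recursive_seen:
  assumes "recursive_in A f" "recursive_in A g"
  shows "recursive_in A (\<lambda>x. seen (f x) (g x))"
  unfolding seen_def
  by (intro recursive_card decidable_R recursive_intros assms(1) recursive_comp[OF assms(2)])

lemma below_eq: "{y. (y, x) \<in> R} = \<phi> ` {..<pos x}"
proof -
  have "y \<in> \<phi> ` {..<pos x}" if "pos y < pos x" for y
    by (rule image_eqI[of _ _ "pos y"]) (use that in simp_all)
  then show ?thesis by (auto simp: mem_R_iff)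
qed

lemma finite_below: "finite {y. (y, x) \<in> R}"
  unfolding below_eq by simp

lemma card_below: "card {y. (y, x) \<in> R} = pos x"
  unfolding below_eq using bij_phi by (simp add: card_image bij_is_inj inj_on_subset[of \<phi> UNIV])

lemma seen_le: "seen s x \<le> pos x"
  unfolding seen_def card_below[symmetric] by (rule card_mono[OF finite_below]) auto

lemma seen_eq_pos_iff: "seen s x = pos x \<longleftrightarrow> (\<forall>y. (y, x) \<in> R \<longrightarrow> y < s)"
proof
  assume "seen s x = pos x"
  then have "{y. y < s \<and> (y, x) \<in> R} = {y. (y, x) \<in> R}"
    unfolding seen_def card_below[symmetric] by (intro card_subset_eq finite_below) auto
  then show "\<forall>y. (y, x) \<in> R \<longrightarrow> y < s" by blast
next
  assume "\<forall>y. (y, x) \<in> R \<longrightarrow> y < s"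
  then have "{y. y < s \<and> (y, x) \<in> R} = {y. (y, x) \<in> R}" by blast
  then show "seen s x = pos x" unfolding seen_def by (simp add: card_below)
qed

lemma ex_seen_eq_pos: "\<exists>s. seen s x = pos x"
  using finite_below[of x] unfolding seen_eq_pos_iff finite_nat_set_iff_bounded by blast

text \<open>The exact position of \<open>g x\<close> reveals a stage by which all predecessors of
  \<open>g x\<close> have appeared. As \<open>x\<close> is not after \<open>g x\<close>, all
  predecessors of \<open>x\<close> have appeared by then too, and counting them gives
  \<open>pos x\<close>.\<close>

lemma recursive_pos_if_dominated:
  assumes "recursive_in A g" "recursive_in A (\<lambda>x. pos (g x))" "\<And>x. pos x \<le> pos (g x)"
  shows "recursive_in A pos"
proof -
  define s where "s x = (LEAST s. seen s (g x) = pos (g x))" for x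
  have "recursive_in A s" unfolding s_def
    by (intro recursive_Least recursive_intros recursive_seen recursive_comp[OF assms(1)]
        recursive_comp[OF assms(2)] ex_seen_eq_pos)
  then have "recursive_in A (\<lambda>x. seen (s x) x)" by (intro recursive_seen recursive_intros)
  moreover have "seen (s x) x = pos x" for x
  proof -
    have "seen (s x) (g x) = pos (g x)" unfolding s_def using ex_seen_eq_pos by (rule LeastI_ex)
    then show ?thesis using assms(3)[of x] unfolding seen_eq_pos_iff mem_R_iff
      by (meson less_le_trans)
  qed
  ultimately show ?thesis by simp
qed

lemma recursive_phi:
  assumes "recursive_in A pos"
  shows "recursive_in A \<phi>"
proof -
  have "\<exists>x. pos x = n" for n by (rule exI[of _ "\<phi> n"]) simp
  then have "recursive_in A (\<lambda>n. LEAST x. pos x = n)"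
    by (intro recursive_intros recursive_comp[OF assms])
  moreover have "(LEAST x. pos x = n) = \<phi> n" for n by (rule Least_equality) auto
  ultimately show ?thesis by simp
qed

definition graph :: "(nat \<Rightarrow> nat) \<Rightarrow> nat set" where
  "graph f = prod_encode ` image_of_graph \<phi> f"

lemma mem_graph_iff: "z \<in> graph f \<longleftrightarrow> psnd z = \<phi> (f (pos (pfst z)))"
proof
  assume "psnd z = \<phi> (f (pos (pfst z)))"
  then have "z = prod_encode (\<phi> (pos (pfst z)), \<phi> (f (pos (pfst z))))"
    using prod_encode_pfst_psnd[of z] by simp
  then show "z \<in> graph f" unfolding graph_def image_of_graph_def by blast
qed (auto simp: graph_def image_of_graph_def)

lemma graph_reducible:
  assumes "computable f" "recursive_in A pos"
  shows "graph f \<le>\<^sub>T A"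
  unfolding turing_reducible_iff mem_graph_iff
  by (intro recursive_intros recursive_comp[OF recursive_phi[OF assms(2)]]
      recursive_comp[OF recursive_in_empty[OF assms(1)[unfolded computable_def]]]
      recursive_comp[OF assms(2)])

lemma recursive_graph: "recursive_in (graph f) (\<lambda>x. \<phi> (f (pos x)))"
proof -
  have "recursive_in (graph f) (\<lambda>x. LEAST y. prod_encode (x, y) \<in> graph f)"
  proof (intro recursive_Least decidable_mem turing_reducible_refl recursive_intros)
    show "\<exists>y. prod_encode (x, y) \<in> graph f" for x by (simp add: mem_graph_iff)
  qed
  moreover have "(LEAST y. prod_encode (x, y) \<in> graph f) = \<phi> (f (pos x))" for x
    by (rule Least_equality) (auto simp: mem_graph_iff)
  ultimately show ?thesis by simp
qed

text \<open>The witness is the region on and below the graph of \<open>pos\<close>. It is c.e.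
  because the computable approximations \<open>seen\<close> reach \<open>pos\<close> from below, and
  \<open>pos x\<close> is found in it as the first \<open>n\<close> whose successor lies
  outside.\<close>

lemma ex_ce_set_pos: "\<exists>C. ce_set C \<and> recursive_in C pos \<and> (\<forall>A. recursive_in A pos \<longrightarrow> C \<le>\<^sub>T A)"
proof (intro exI conjI allI impI)
  let ?C = "{z. psnd z \<le> pos (pfst z)}"
  have "psnd z \<le> pos (pfst z) \<longleftrightarrow> (\<exists>s. psnd z \<le> seen s (pfst z))" for z
    using ex_seen_eq_pos seen_le by (metis le_trans)
  moreover have "decidable_in {} (\<lambda>w. psnd (psnd w) \<le> seen (pfst w) (pfst (psnd w)))"
    by (intro recursive_intros recursive_seen)
  ultimately show "ce_set ?C" using ce_set_ex[of "\<lambda>s z. psnd z \<le> seen s (pfst z)"] by simp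
  have "recursive_in ?C (\<lambda>x. LEAST n. \<not> prod_encode (x, Suc n) \<in> ?C)"
  proof (intro recursive_Least decidable_not decidable_mem turing_reducible_refl recursive_intros)
    show "\<exists>n. \<not> prod_encode (x, Suc n) \<in> ?C" for x by (rule exI[of _ "pos x"]) simp
  qed
  moreover have "(LEAST n. \<not> prod_encode (x, Suc n) \<in> ?C) = pos x" for x
    by (rule Least_equality) auto
  ultimately show "recursive_in ?C pos" by simp
  show "?C \<le>\<^sub>T A" if "recursive_in A pos" for A
    unfolding turing_reducible_iff mem_Collect_eq
    by (intro recursive_intros recursive_comp[OF that])
qed

end

section \<open>Building a copy from an enumeration\<close>

lemma ex_iso_from_omega:
  assumes trans: "\<And>x y z. (x, y) \<in> R \<Longrightarrow> (y, z) \<in> R \<Longrightarrow> (x, z) \<in> R"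
    and irrefl: "\<And>x. (x, x) \<notin> R"
    and total: "\<And>x y. x \<noteq> y \<Longrightarrow> (x, y) \<in> R \<or> (y, x) \<in> R"
    and fin: "\<And>x. finite {y. (y, x) \<in> R}"
  shows "\<exists>\<phi>. iso_from_omega R \<phi>"
proof -
  define p where "p x = card {y. (y, x) \<in> R}" for x
  have mono: "p x < p y" if "(x, y) \<in> R" for x y
    unfolding p_def using that trans irrefl by (intro psubset_card_mono fin) blast
  have iff: "(x, y) \<in> R \<longleftrightarrow> p x < p y" for x y
    using mono total by (metis less_asym' less_irrefl)
  have inj: "inj p" using mono total by (metis injI less_irrefl)
  \<comment> \<open>\<open>p\<close> maps the predecessors of \<open>x\<close> injectively into a
    set of the same finite size, hence onto it. So the range of \<open>p\<close> is closed
    downwards, and being infinite it contains every number.\<close>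
  have below: "p ` {y. (y, x) \<in> R} = {..<p x}" for x
  proof (rule card_subset_eq)
    have "card (p ` {y. (y, x) \<in> R}) = card {y. (y, x) \<in> R}"
      using inj by (intro card_image) (rule inj_on_subset, auto)
    then show "card (p ` {y. (y, x) \<in> R}) = card {..<p x}"
      by (simp only: card_lessThan p_def[of x])
  qed (auto intro: mono)
  have "n \<in> range p" for n
  proof -
    have "infinite (range p)" using inj by (simp add: finite_image_iff)
    then obtain x where "\<not> p x < Suc n" unfolding finite_nat_set_iff_bounded by blast
    then have "n < p x" by simp
    then show ?thesis using below[of x] by blast
  qed
  then have "bij p" using inj by (auto simp: bij_def)
  then have "bij (inv p)" "p (inv p n) = n" for n
    by (auto simp: bij_imp_bij_inv bij_is_surj surj_f_inv_f)
  then show ?thesis unfolding iso_from_omega_def iff by auto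
qed

context enumeration
begin

text \<open>The class of \<open>n\<close> in this order gains a second element when \<open>n\<close> is enumerated, so
  positions are as hard to compute as the enumerated set.\<close>

definition key_order :: "(nat \<times> nat) set" where
  "key_order = {(x, y). key x < key y \<or> key x = key y \<and> x < y}"

lemma mem_key_order_iff: "(x, y) \<in> key_order \<longleftrightarrow> key x < key y \<or> key x = key y \<and> x < y"
  unfolding key_order_def by simp

lemma computable_key_order: "computable_set (prod_encode ` key_order)"
proof -
  have "z \<in> prod_encode ` key_order \<longleftrightarrow>
      key (pfst z) < key (psnd z) \<or> key (pfst z) = key (psnd z) \<and> pfst z < psnd z" for z
    using inj_image_mem_iff[OF inj_prod_encode, of "(pfst z, psnd z)" key_order]
    by (simp add: mem_key_order_iff)
  moreover have "decidable_in {} (\<lambda>z. key (pfst z) < key (psnd z) \<or>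
      key (pfst z) = key (psnd z) \<and> pfst z < psnd z)"
    by (intro recursive_intros recursive_key)
  ultimately show ?thesis unfolding computable_set_def computable_def decidable_in_def by simp
qed

lemma ex_iso_key_order: "\<exists>\<phi>. iso_from_omega key_order \<phi>"
proof (rule ex_iso_from_omega)
  fix x
  have "{y. (y, x) \<in> key_order} \<subseteq> {y. key y \<le> key x}" by (auto simp: mem_key_order_iff)
  then show "finite {y. (y, x) \<in> key_order}" using finite_key_le finite_subset by blast
qed (auto simp: mem_key_order_iff)

lemma key_order_pos:
  assumes "iso_from_omega key_order \<phi>"
  defines "B \<equiv> {x. \<exists>s. Q s x}"
  shows "recursive_in B (copy.pos \<phi>)" and "recursive_in A (copy.pos \<phi>) \<Longrightarrow> B \<le>\<^sub>T A"
proof -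
  interpret copy key_order \<phi>
    using assms(1) computable_key_order by unfold_locales
  \<comment> \<open>The entry stage of \<open>x\<close>, with default 0 outside \<open>B\<close>,
    where the condition holds vacuously.\<close>
  define \<sigma> where "\<sigma> x = (LEAST s. x \<in> B \<longrightarrow> Q s x)" for x
  have ex: "\<exists>s. x \<in> B \<longrightarrow> Q s x" for x unfolding B_def by blast
  have sigma: "\<sigma> x = s" if "Q s x" for s x
    using LeastI_ex[OF ex[of x]] that Q_unique unfolding \<sigma>_def B_def by blast
  have "recursive_in B \<sigma>" unfolding \<sigma>_def
    by (intro recursive_Least recursive_intros decidable_Q_comp decidable_mem
        turing_reducible_refl ex)
  note rec_sigma = recursive_comp[OF this]
  \<comment> \<open>A predecessor of \<open>x\<close> has key at most \<open>key x\<close> and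
    either is its own key or pairs its key with the entry stage of that key. So \<open>N x\<close>
    exceeds all predecessors of \<open>x\<close>.\<close>
  define N where "N x = (LEAST N. key x < N \<and> (\<forall>y<Suc (key x). prod_encode (y, \<sigma> y) < N))" for x
  have ex: "\<exists>N. key x < N \<and> (\<forall>y<Suc (key x). prod_encode (y, \<sigma> y) < N)" for x
  proof -
    have "finite (insert (key x) ((\<lambda>y. prod_encode (y, \<sigma> y)) ` {..<Suc (key x)}))" by simp
    then show ?thesis unfolding finite_nat_set_iff_bounded by (auto simp del: lessThan_Suc)
  qed
  have "recursive_in B N" unfolding N_def
    by (intro recursive_Least recursive_intros recursive_key rec_sigma ex)
  then have "recursive_in B (\<lambda>x. seen (N x) x)" by (intro recursive_seen recursive_intros)
  moreover have "seen (N x) x = pos x" for x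
    unfolding seen_eq_pos_iff
  proof (intro allI impI)
    fix y assume "(y, x) \<in> key_order"
    then have y: "key y \<le> key x" by (auto simp: mem_key_order_iff)
    have N: "key x < N x" "\<And>y. y \<le> key x \<Longrightarrow> prod_encode (y, \<sigma> y) < N x"
      using LeastI_ex[OF ex[of x]] unfolding N_def[symmetric] by auto
    show "y < N x"
    proof (cases y rule: key_cases)
      case 1
      then show ?thesis using N(2)[OF y] sigma by metis
    next
      case 2
      then show ?thesis using N(1) y by simp
    qed
  qed
  ultimately show "recursive_in B pos" by simp

  assume pos: "recursive_in A pos"
  \<comment> \<open>If \<open>x\<close> enters at stage \<open>s\<close>, the pair of
    \<open>x\<close> and \<open>s\<close> has key \<open>x\<close> and precedes \<open>g x\<close>.
    By stage \<open>t x\<close> all predecessors of \<open>g x\<close> have appeared, so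
    \<open>s\<close> is below \<open>t x\<close> and a bounded search decides membership in
    \<open>B\<close>.\<close>
  define g where "g x = (LEAST y. x < key y)" for x
  have g: "x < key (g x)" for x unfolding g_def by (rule LeastI_ex[OF ex_key_greater])
  have "recursive_in A g" unfolding g_def
    by (intro recursive_Least recursive_intros recursive_key ex_key_greater)
  note rec_g = recursive_comp[OF this]
  define t where "t x = (LEAST s. seen s (g x) = pos (g x))" for x
  have "recursive_in A t" unfolding t_def
    by (intro recursive_Least recursive_intros recursive_seen recursive_comp[OF pos] rec_g
        ex_seen_eq_pos)
  then have "decidable_in A (\<lambda>x. \<exists>s<t x. Q s x)" by (intro recursive_intros decidable_Q_comp)
  moreover have "(\<exists>s<t x. Q s x) \<longleftrightarrow> x \<in> B" for x
  proof
    assume "x \<in> B"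
    then obtain s where s: "Q s x" unfolding B_def by blast
    have "(prod_encode (x, s), g x) \<in> key_order"
      using key_prod_encode[OF s] g[of x] by (simp add: mem_key_order_iff)
    moreover have "seen (t x) (g x) = pos (g x)"
      unfolding t_def by (rule LeastI_ex[OF ex_seen_eq_pos])
    ultimately have "prod_encode (x, s) < t x" unfolding seen_eq_pos_iff by blast
    then show "\<exists>s<t x. Q s x" using s le_prod_encode_2[of s x] by (blast intro: le_less_trans)
  qed (auto simp: B_def)
  ultimately show "B \<le>\<^sub>T A" unfolding turing_reducible_iff by simp
qed

section \<open>The function\<close>

text \<open>Truncated subtraction gives \<open>fn 0 = 0\<close>; doubling is written as a sum so
  that the closure rules apply.\<close>

definition fn :: "nat \<Rightarrow> nat" where
  "fn n = (if even n then n - 2 else key (n div 2) + key (n div 2))"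

lemma fn_even: "fn (2 * n) = 2 * (n - 1)"
  unfolding fn_def by (simp add: diff_mult_distrib2)

lemma fn_odd: "fn (Suc (2 * n)) = 2 * key n"
  unfolding fn_def by simp

lemma even_fn: "even (fn n)"
  unfolding fn_def by simp

lemma computable_fn: "computable fn"
  unfolding computable_def fn_def by (intro recursive_intros recursive_key)

lemma fn_le: "fn n \<le> n"
proof (cases "even n")
  case False
  then show ?thesis unfolding fn_def using key_le[of "n div 2"] by auto
qed (simp add: fn_def)

lemma quasi_block_fn: "quasi_block fn"
  unfolding quasi_block_def by (auto intro!: exI[of _ n for n] intro: le_less_trans[OF fn_le])

lemma finite_fn_le: "finite {n. fn n \<le> k}"
proof (rule finite_subset)
  show "{n. fn n \<le> k} \<subseteq> {..k + 2} \<union> (\<lambda>m. Suc (2 * m)) ` {m. key m \<le> k}"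
  proof
    fix n assume "n \<in> {n. fn n \<le> k}"
    then have n: "fn n \<le> k" by simp
    show "n \<in> {..k + 2} \<union> (\<lambda>m. Suc (2 * m)) ` {m. key m \<le> k}"
    proof (cases "even n")
      case True
      then show ?thesis using n by (auto simp: fn_def le_diff_conv)
    next
      case False
      then obtain m where "n = Suc (2 * m)" by (auto elim: oddE)
      then show ?thesis using n by (auto simp: fn_odd)
    qed
  qed
qed (simp add: finite_key_le)

section \<open>Lower bounds of the function\<close>

lemma ex_diverging_lower_bound: "\<exists>h. diverging_lower_bound h fn"
proof -
  \<comment> \<open>The minimum of \<open>fn\<close> over the tail from \<open>n\<close>. It grows
    as tails shrink, and diverges because only finitely many arguments have values at most
    \<open>k\<close>.\<close>
  define h where "h n = (LEAST v. \<exists>m\<ge>n. fn m = v)" for n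
  have h: "\<exists>m\<ge>n. fn m = h n" for n unfolding h_def by (rule LeastI_ex) blast
  have le: "h n \<le> fn m" if "n \<le> m" for n m unfolding h_def using that by (intro Least_le) blast
  have "mono h" using h le by (metis monoI le_trans)
  moreover have "filterlim h at_top sequentially"
    unfolding filterlim_at_top eventually_sequentially
  proof
    fix k
    obtain N where N: "\<And>n. fn n \<le> k \<Longrightarrow> n < N"
      using finite_fn_le[of k] unfolding finite_nat_set_iff_bounded by auto
    have "k \<le> h n" if "N \<le> n" for n
      using h[of n] N that by (metis le_trans linorder_not_le nat_le_linear)
    then show "\<exists>N. \<forall>n\<ge>N. k \<le> h n" by blast
  qed
  ultimately show ?thesis unfolding diverging_lower_bound_def using le by blast
qed

text \<open>If \<open>x\<close> enters at stage \<open>s\<close> and \<open>m\<close> codes the pair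
  of \<open>x\<close> and \<open>s\<close>, then
  \<open>h (2 * m + 1) \<le> fn (2 * m + 1) = 2 * x < h (M x)\<close>. Monotonicity gives
  \<open>2 * m + 1 < M x\<close>, so \<open>M x\<close> bounds the entry stage.\<close>

lemma decidable_if_computable_lower_bound:
  assumes "computable h" "diverging_lower_bound h fn"
  shows "decidable_in {} (\<lambda>x. \<exists>s. Q s x)"
proof -
  have h: "mono h" "\<And>n. h n \<le> fn n" "filterlim h at_top sequentially"
    using assms(2) unfolding diverging_lower_bound_def by auto
  have ex: "\<exists>n. x + x < h n" for x
    using h(3)[unfolded filterlim_at_top, rule_format, of "Suc (x + x)"]
    unfolding eventually_sequentially Suc_le_eq by blast
  define M where "M x = (LEAST n. x + x < h n)" for x
  have "recursive_in {} M" unfolding M_def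
    by (intro recursive_Least recursive_intros recursive_comp[OF assms(1)[unfolded computable_def]] ex)
  then have "decidable_in {} (\<lambda>x. \<exists>s<M x. Q s x)" by (intro recursive_intros decidable_Q_comp)
  moreover have "s < M x" if "Q s x" for s x
  proof -
    let ?m = "prod_encode (x, s)"
    have "h (Suc (2 * ?m)) < h (M x)"
      using h(2)[of "Suc (2 * ?m)"] LeastI_ex[OF ex[of x]] unfolding M_def[symmetric]
      by (simp add: fn_odd key_prod_encode[OF that])
    then have "Suc (2 * ?m) < M x" using h(1) by (meson monoD linorder_not_le)
    then show ?thesis using le_prod_encode_2[of s x] by linarith
  qed
  then have "(\<exists>s<M x. Q s x) \<longleftrightarrow> (\<exists>s. Q s x)" for x by blast
  ultimately show ?thesis by simp
qed

text \<open>The graph yields \<open>F\<close>, the image of \<open>fn\<close> in the copy. Each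
  \<open>x\<close> is dominated by some value \<open>g x\<close> of \<open>F\<close>; its position
  is even and is found by counting the applications of \<open>F\<close> that lead from
  \<open>g x\<close> to the least element.\<close>

lemma recursive_pos_graph_fn:
  assumes "copy R \<phi>"
  shows "recursive_in (copy.graph \<phi> fn) (copy.pos \<phi>)"
proof -
  interpret copy R \<phi> by fact
  define F where "F x = \<phi> (fn (pos x))" for x
  have pos_F: "pos (F x) = fn (pos x)" for x unfolding F_def by simp
  note rec_F = recursive_comp[OF recursive_graph[of fn, folded F_def]]
  \<comment> \<open>At position \<open>2 * Suc (pos x)\<close> the function takes the value
    \<open>2 * pos x\<close>, which is not before \<open>pos x\<close>.\<close>
  have ex: "\<exists>z. \<not> (F z, x) \<in> R" for x
    by (rule exI[of _ "\<phi> (2 * Suc (pos x))"])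
      (simp add: mem_R_iff pos_F fn_even[of "Suc _", simplified])
  define g where "g x = F (LEAST z. \<not> (F z, x) \<in> R)" for x
  have g: "pos x \<le> pos (g x)" for x
    using LeastI_ex[OF ex[of x]] unfolding g_def by (simp add: mem_R_iff)
  have "recursive_in (graph fn) (\<lambda>x. LEAST z. \<not> (F z, x) \<in> R)"
    by (intro recursive_Least recursive_intros decidable_R rec_F ex)
  then have rec_g: "recursive_in (graph fn) g" unfolding g_def by (rule rec_F)
  \<comment> \<open>On even positions \<open>F\<close> steps down by 2 and rests at 0, as the
    truncated \<open>m - k\<close> expresses.\<close>
  have "pos ((F ^^ k) x) = 2 * (m - k)" if "pos x = 2 * m" for k x m
    by (induction k) (simp_all add: that pos_F fn_even)
  then have root: "(F ^^ k) x = \<phi> 0 \<longleftrightarrow> m \<le> k" if "pos x = 2 * m" for k x m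
    using that by (metis pos_phi phi_pos diff_is_0_eq mult_is_0 zero_neq_numeral)
  have g_even: "pos (g x) = 2 * (pos (g x) div 2)" for x
    unfolding g_def pos_F using even_fn by simp
  \<comment> \<open>The least element \<open>\<phi> 0\<close> is a fixed number and enters the
    program as a constant.\<close>
  define k where "k x = (LEAST k. (F ^^ k) (g x) = \<phi> 0)" for x
  have ex: "\<exists>k. (F ^^ k) (g x) = \<phi> 0" for x using root[OF g_even] by blast
  have "recursive_in (graph fn) k" unfolding k_def
    by (intro recursive_Least recursive_intros rec_F recursive_comp[OF rec_g] ex)
  then have "recursive_in (graph fn) (\<lambda>x. k x + k x)" by (intro recursive_intros)
  moreover have "k x + k x = pos (g x)" for x
  proof -
    have "k x = pos (g x) div 2"
      unfolding k_def by (rule Least_equality) (simp_all add: root[OF g_even])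
    then show ?thesis using g_even[of x] by simp
  qed
  ultimately have "recursive_in (graph fn) (\<lambda>x. pos (g x))" by simp
  from recursive_pos_if_dominated[OF rec_g this g] show ?thesis .
qed

lemma degree_spectrum_fn: "degree_spectrum fn = ce_degrees"
proof
  show "degree_spectrum fn \<subseteq> ce_degrees"
  proof
    fix d assume "d \<in> degree_spectrum fn"
    then obtain R \<phi> where d: "d = turing_degree (prod_encode ` image_of_graph \<phi> fn)"
      and R: "computable_copy R" "iso_from_omega R \<phi>"
      unfolding degree_spectrum_def by blast
    interpret copy R \<phi> using R by (simp add: copy_def computable_copy_def)
    obtain C where C: "ce_set C" "recursive_in C pos" "\<And>A. recursive_in A pos \<Longrightarrow> C \<le>\<^sub>T A"
      using ex_ce_set_pos by blast
    \<comment> \<open>Both sets are equivalent to \<open>pos\<close>, which computes the graph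
      because \<open>fn\<close> is computable.\<close>
    have "turing_degree (graph fn) = turing_degree C"
      using graph_reducible[OF computable_fn C(2)] C(3)[OF recursive_pos_graph_fn[OF copy_axioms]]
      by (rule turing_degree_eqI)
    then show "d \<in> ce_degrees" using C(1) unfolding d graph_def ce_degrees_def by blast
  qed
  show "ce_degrees \<subseteq> degree_spectrum fn"
  proof
    fix d assume "d \<in> ce_degrees"
    then obtain B where B: "ce_set B" "d = turing_degree B" unfolding ce_degrees_def by blast
    obtain P where P: "decidable_in {} (\<lambda>z. P (pfst z) (psnd z))" "\<And>x. x \<in> B \<longleftrightarrow> (\<exists>s. P s x)"
      "\<And>s t x. P s x \<Longrightarrow> P t x \<Longrightarrow> s = t"
      using ce_set_stages[OF B(1)] by blast
    \<comment> \<open>The order is built from the enumeration \<open>P\<close> of \<open>B\<close>,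
      while \<open>fn\<close> still belongs to the fixed enumeration \<open>Q\<close>.\<close>
    interpret B: enumeration P using P(1,3) by unfold_locales
    obtain \<phi> where iso: "iso_from_omega B.key_order \<phi>" using B.ex_iso_key_order by blast
    interpret copy B.key_order \<phi> using iso B.computable_key_order by unfold_locales
    have B_eq: "B = {x. \<exists>s. P s x}" using P(2) by blast
    note pos = B.key_order_pos[OF iso, folded B_eq]
    have "turing_degree (graph fn) = turing_degree B"
      using graph_reducible[OF computable_fn pos(1)] pos(2)[OF recursive_pos_graph_fn[OF copy_axioms]]
      by (rule turing_degree_eqI)
    moreover have "computable_copy B.key_order"
      using iso B.computable_key_order unfolding computable_copy_def by blast
    ultimately show "d \<in> degree_spectrum fn"
      using iso B(2) unfolding degree_spectrum_def graph_def by blast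
  qed
qed

end

theorem theorem6:
  "\<exists>f :: nat \<Rightarrow> nat.
     computable f \<and> quasi_block f \<and>
     (\<exists>h. diverging_lower_bound h f) \<and>
     \<not> (\<exists>h. computable h \<and> diverging_lower_bound h f) \<and>
     degree_spectrum f = ce_degrees"
proof -
  obtain K where K: "ce_set K" "\<not> decidable_in {} (\<lambda>x. x \<in> K)"
    using ex_undecidable_ce_set by blast
  obtain Q where Q: "decidable_in {} (\<lambda>z. Q (pfst z) (psnd z))" "\<And>x. x \<in> K \<longleftrightarrow> (\<exists>s. Q s x)"
    "\<And>s t x. Q s x \<Longrightarrow> Q t x \<Longrightarrow> s = t"
    using ce_set_stages[OF K(1)] by blast
  interpret enumeration Q using Q(1,3) by unfold_locales
  \<comment> \<open>A computable diverging lower bound would decide \<open>K\<close>.\<close>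
  have "\<not> (\<exists>h. computable h \<and> diverging_lower_bound h fn)"
    using decidable_if_computable_lower_bound K(2) unfolding Q(2) by blast
  then show ?thesis
    using computable_fn quasi_block_fn ex_diverging_lower_bound degree_spectrum_fn by blast
qed

end
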